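(* Let $F\colon \mathbb{R}^n\rightrightarrows \mathbb{R}^p$ be a nearly convex set-valued mapping. If $\bar x\in \mathrm{ri}(\mathrm{dom}\, F)$, then $F(\bar x)$ is nearly convex. In particular, $\mathrm{ri}\, F(\bar x)$ is nonempty.
   Context: A set $\Omega\subset\mathbb{R}^k$ is nearly convex if there exists a convex set $C\subset\mathbb{R}^k$ such that $C\subset\Omega\subset\overline{C}$, where $\overline{C}$ is the closure of $C$. For an arbitrary set $\Omega\subset\mathbb{R}^k$, the relative interior is $\mathrm{ri}\,\Omega=\{a\in\Omega \mid \text{there exists } \delta>0 \text{ with } B(a;\delta)\cap \mathrm{aff}\,\Omega\subset\Omega\}$, where $\mathrm{aff}\,\Omega$ is the affine hull and $B(a;\delta)$ the open ball. A set-valued mapping $F\colon\mathbb{R}^n\rightrightarrows\mathbb{R}^p$ assigns to each $x\in\mathbb{R}^n$ a (possibly empty) subset $F(x)\subset\mathbb{R}^p$; $\mathrm{dom}\,F=\{x\mid F(x)\neq\emptyset\}$ and $\mathrm{gph}\,F=\{(x,y)\in\mathbb{R}^n\times\mathbb{R}^p\mid y\in F(x)\}$. $F$ is nearly convex if $\mathrm{gph}\,F$ is a nearly convex set. *)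

theory Defs
  imports "HOL-Analysis.Analysis"
begin

definition nearly_convex :: "'a::euclidean_space set \<Rightarrow> bool" where
  "nearly_convex \<Omega> \<longleftrightarrow> (\<exists>C. convex C \<and> C \<subseteq> \<Omega> \<and> \<Omega> \<subseteq> closure C)"

text \<open>A set-valued mapping from \<open>'a\<close> to \<open>'b\<close> is a function \<open>'a \<Rightarrow> 'b set\<close>; its values may be empty.\<close>

definition svm_dom :: "('a \<Rightarrow> 'b set) \<Rightarrow> 'a set" where
  "svm_dom F = {x. F x \<noteq> {}}"

definition svm_gph :: "('a \<Rightarrow> 'b set) \<Rightarrow> ('a \<times> 'b) set" where
  "svm_gph F = {(x, y). y \<in> F x}"

definition nearly_convex_map :: "('a::euclidean_space \<Rightarrow> 'b::euclidean_space set) \<Rightarrow> bool" where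
  "nearly_convex_map F \<longleftrightarrow> nearly_convex (svm_gph F)"

end

theory Submission
  imports Defs
begin

text \<open>If \<open>C\<close> is convex with \<open>C \<subseteq> gph F \<subseteq> closure C\<close>, then the fibre over \<open>xbar\<close> of the relative interior
  of \<open>C\<close> is a convex set witnessing the near convexity of \<open>F xbar\<close>. It is nonempty because
  relative interiors of convex sets commute with the projection to the domain; it is dense in
  \<open>F xbar\<close> because half-open segments from a relative interior point of \<open>C\<close> to a point of its
  closure stay in the relative interior.\<close>

text \<open>\<open>C\<close>, \<open>S\<close> and \<open>closure C\<close> have the same affine
  hull, so \<open>rel_interior\<close> is monotone along this chain; its two ends agree because
  \<open>C\<close> is convex.\<close>

lemma rel_interior_between_closure:
  fixes C S :: "'a::euclidean_space set"
  assumes "convex C" "C \<subseteq> S" "S \<subseteq> closure C"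
  shows "rel_interior S = rel_interior C"
proof
  have "affine hull S \<subseteq> affine hull C"
    using hull_mono[OF assms(3), of affine] by simp
  then have hull: "affine hull S = affine hull C"
    using hull_mono[OF assms(2), of affine] by blast
  show "rel_interior C \<subseteq> rel_interior S"
    using subset_rel_interior[OF assms(2)] hull by simp
  show "rel_interior S \<subseteq> rel_interior C"
    using subset_rel_interior[OF assms(3)] hull convex_rel_interior_closure[OF assms(1)] by simp
qed

lemma rel_interior_nearly_convex_nonempty:
  assumes "nearly_convex S" "S \<noteq> {}"
  shows "rel_interior S \<noteq> {}"
proof -
  obtain C where C: "convex C" "C \<subseteq> S" "S \<subseteq> closure C"
    using assms(1) unfolding nearly_convex_def by blast
  then have "C \<noteq> {}"
    using assms(2) by auto
  then show ?thesis
    using rel_interior_between_closure[OF C] rel_interior_eq_empty[OF C(1)] by simp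
qed

lemma fibre_closure_subset:
  fixes C :: "('a::euclidean_space \<times> 'b::euclidean_space) set"
  assumes "convex C" "(x, y0) \<in> rel_interior C" "(x, y) \<in> closure C"
  shows "y \<in> closure {y. (x, y) \<in> rel_interior C}" (is "_ \<in> closure ?K")
proof (cases "y = y0")
  case True
  then show ?thesis
    using assms(2) closure_subset[of ?K] by blast
next
  case False
  \<comment> \<open>For distinct endpoints the closure of the open segment contains
    \<open>y\<close>; for equal ones the open segment is empty, hence the case split.\<close>
  have "open_segment y y0 \<subseteq> ?K"
  proof
    fix z assume "z \<in> open_segment y y0"
    then obtain u where u: "0 < u" "u < 1" "z = (1 - u) *\<^sub>R y + u *\<^sub>R y0"
      by (auto simp: in_segment)
    have "(x, y) - u *\<^sub>R ((x, y) - (x, y0)) \<in> rel_interior C"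
      using rel_interior_closure_convex_shrink[OF assms(1,2,3)] u by simp
    also have "(x, y) - u *\<^sub>R ((x, y) - (x, y0)) = (x, z)"
      by (simp add: u(3) algebra_simps)
    finally show "z \<in> ?K" by simp
  qed
  then have "closure (open_segment y y0) \<subseteq> closure ?K"
    by (rule closure_mono)
  then show ?thesis
    using False by (auto simp: closure_open_segment)
qed

lemma rel_interior_svm_dom:
  fixes F :: "'a::euclidean_space \<Rightarrow> 'b::euclidean_space set"
  assumes "convex C" "C \<subseteq> svm_gph F" "svm_gph F \<subseteq> closure C"
  shows "rel_interior (svm_dom F) = fst ` rel_interior C"
proof -
  have dom: "svm_dom F = fst ` svm_gph F"
    by (force simp: svm_dom_def svm_gph_def)
  have lin: "linear (fst :: 'a \<times> 'b \<Rightarrow> 'a)"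
    by (rule linear_fst)
  have "fst ` C \<subseteq> svm_dom F"
    using assms(2) dom by blast
  moreover have "svm_dom F \<subseteq> closure (fst ` C)"
    using assms(3) dom closure_linear_image_subset[OF lin, of C] by blast
  ultimately have "rel_interior (svm_dom F) = rel_interior (fst ` C)"
    using rel_interior_between_closure convex_linear_image[OF lin assms(1)] by blast
  then show ?thesis
    using rel_interior_convex_linear_image[OF lin assms(1)] by simp
qed

lemma nearly_convex_fibre:
  fixes F :: "'a::euclidean_space \<Rightarrow> 'b::euclidean_space set"
  assumes "nearly_convex_map F" "x \<in> rel_interior (svm_dom F)"
  shows "nearly_convex (F x)"
proof -
  obtain C where C: "convex C" "C \<subseteq> svm_gph F" "svm_gph F \<subseteq> closure C"
    using assms(1) unfolding nearly_convex_map_def nearly_convex_def by blast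
  obtain y0 where y0: "(x, y0) \<in> rel_interior C"
    using assms(2) rel_interior_svm_dom[OF C] by force
  let ?K = "{y. (x, y) \<in> rel_interior C}"
  \<comment> \<open>Slicing with a vertical subspace and projecting both preserve convexity.\<close>
  have "?K = snd ` (rel_interior C \<inter> {x} \<times> UNIV)"
    by force
  then have "convex ?K"
    using C(1) by (simp add: convex_linear_image linear_snd convex_Int convex_Times
        convex_rel_interior)
  moreover have "?K \<subseteq> F x"
    using C(2) rel_interior_subset[of C] by (auto simp: svm_gph_def)
  moreover have "F x \<subseteq> closure ?K"
    using C(3) fibre_closure_subset[OF C(1) y0] by (auto simp: svm_gph_def)
  ultimately show ?thesis
    unfolding nearly_convex_def by blast
qed

theorem theorem3p9:
  fixes F :: "real ^ 'n \<Rightarrow> (real ^ 'p) set" and xbar :: "real ^ 'n"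
  assumes "nearly_convex_map F"
    and "xbar \<in> rel_interior (svm_dom F)"
  shows "nearly_convex (F xbar) \<and> rel_interior (F xbar) \<noteq> {}"
proof
  show nc: "nearly_convex (F xbar)"
    using assms by (rule nearly_convex_fibre)
  \<comment> \<open>The empty set is nearly convex too, so nonemptiness has to come from
    \<open>xbar\<close> lying in the domain.\<close>
  have "F xbar \<noteq> {}"
    using assms(2) rel_interior_subset[of "svm_dom F"] by (auto simp: svm_dom_def)
  with nc show "rel_interior (F xbar) \<noteq> {}"
    by (rule rel_interior_nearly_convex_nonempty)
qed

end
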